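(* Let $X$ be a Banach space and $T\in L(X)$. (i) If $T^{\dagger}$ exists, then $T^*$ has a Moore-Penrose inverse and $(T^* )^{\dagger}=(T^{\dagger})^*$. (ii) Suppose that $(T^* )^{\dagger}\in L(X^* )$ exists and that there is $S\in L(X)$ such that $S^*=(T^* )^{\dagger}$. Then $T^{\dagger}$ exists and $S=T^{\dagger}$. In particular, if $X$ is reflexive, then $T\in L(X)$ has a Moore-Penrose inverse if and only if $(T^* )^{\dagger}$ exists.
   Context: Scalars are complex. For a Banach space $X$, $L(X)$ is the Banach algebra of bounded linear operators on $X$ with the operator norm; $X^*$ is the dual Banach space and $T^*\in L(X^* )$ is the Banach space adjoint of $T\in L(X)$. An operator $H\in L(X)$ is hermitian if $\|\exp(itH)\|=1$ for all $t\in\mathbb{R}$. The Moore-Penrose inverse of $T\in L(X)$, denoted $T^{\dagger}$, is the (at most one) $S\in L(X)$ with $T=TST$, $S=STS$, and $TS$ and $ST$ hermitian. *)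

theory Defs
  imports "HOL-Analysis.Analysis"
begin

section \<open>Complex Banach spaces\<close>

text \<open>The library's class \<open>banach\<close> is about real scalars. A complex Banach space is a real one with a
  compatible scalar multiplication by complex numbers for which the norm is homogeneous.\<close>

class cbanach = banach +
  fixes scaleC :: "complex \<Rightarrow> 'a \<Rightarrow> 'a"  (infixr "*\<^sub>C" 75)
  assumes scaleC_add_right: "a *\<^sub>C (x + y) = a *\<^sub>C x + a *\<^sub>C y"
    and scaleC_add_left: "(a + b) *\<^sub>C x = a *\<^sub>C x + b *\<^sub>C x"
    and scaleC_scaleC: "a *\<^sub>C (b *\<^sub>C x) = (a * b) *\<^sub>C x"
    and scaleC_of_real: "of_real r *\<^sub>C x = r *\<^sub>R x"
    and norm_scaleC: "norm (a *\<^sub>C x) = cmod a * norm x"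

lemma scaleC_one [simp]: "1 *\<^sub>C x = (x :: 'a :: cbanach)"
  using scaleC_of_real[of 1 x] by simp

lemma scaleC_zero_right [simp]: "a *\<^sub>C 0 = (0 :: 'a :: cbanach)"
  using scaleC_add_right[of a 0 "0 :: 'a"] by simp

lemma scaleC_minus_right: "a *\<^sub>C (- x) = - (a *\<^sub>C x)" for x :: "'a :: cbanach"
  using scaleC_add_right[of a x "- x"] by (simp add: eq_neg_iff_add_eq_0 add.commute)

lemma scaleC_diff_right: "a *\<^sub>C (x - y) = a *\<^sub>C x - a *\<^sub>C y" for x :: "'a :: cbanach"
  using scaleC_add_right[of a x "- y"] by (simp add: scaleC_minus_right)

lemma scaleC_scaleR: "a *\<^sub>C (r *\<^sub>R x) = r *\<^sub>R (a *\<^sub>C x)" for x :: "'a :: cbanach"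
  by (metis scaleC_of_real scaleC_scaleC mult.commute)

lemma bounded_linear_scaleC: "bounded_linear (\<lambda>x. a *\<^sub>C x :: 'a :: cbanach)"
  by (rule bounded_linear_intro[where K = "cmod a"])
    (simp_all add: scaleC_add_right scaleC_scaleR norm_scaleC mult.commute)

instantiation complex :: cbanach
begin

definition scaleC_complex :: "complex \<Rightarrow> complex \<Rightarrow> complex"
  where "scaleC_complex a x = a * x"

instance
  by standard (simp_all add: scaleC_complex_def algebra_simps norm_mult scaleR_conv_of_real)

end


section \<open>Bounded complex-linear operators\<close>

definition bounded_clinear :: "('a :: cbanach \<Rightarrow> 'b :: cbanach) \<Rightarrow> bool"
  where "bounded_clinear f \<longleftrightarrow> bounded_linear f \<and> (\<forall>a x. f (a *\<^sub>C x) = a *\<^sub>C f x)"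

lemma bounded_clinearI:
  assumes "\<And>x y. f (x + y) = f x + f y" "\<And>a x. f (a *\<^sub>C x) = a *\<^sub>C f x"
    and "\<And>x. norm (f x) \<le> norm x * K"
  shows "bounded_clinear f"
  unfolding bounded_clinear_def using assms
  by (auto intro!: bounded_linear_intro[where K = K] simp flip: scaleC_of_real)

lemma bounded_clinear_scaleR: "bounded_clinear f \<Longrightarrow> f (r *\<^sub>R x) = r *\<^sub>R f x"
  by (metis bounded_clinear_def scaleC_of_real)

text \<open>Carving the operators out of the library's real-linear ones makes the operator norm
  the library's \<open>onorm\<close>.\<close>

typedef (overloaded) ('a, 'b) cblinfun  ("(_ \<Rightarrow>\<^sub>C\<^sub>L /_)" [22, 21] 21) =
  "{f :: 'a :: cbanach \<Rightarrow>\<^sub>L 'b :: cbanach. \<forall>a x. blinfun_apply f (a *\<^sub>C x) = a *\<^sub>C blinfun_apply f x}"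
  morphisms blinfun_of_cblinfun Abs_cblinfun
  by (intro exI[of _ 0]) simp

setup_lifting type_definition_cblinfun

lift_definition cblinfun_apply :: "('a :: cbanach \<Rightarrow>\<^sub>C\<^sub>L 'b :: cbanach) \<Rightarrow> 'a \<Rightarrow> 'b" is blinfun_apply .

definition CBlinfun :: "('a :: cbanach \<Rightarrow> 'b :: cbanach) \<Rightarrow> ('a \<Rightarrow>\<^sub>C\<^sub>L 'b)"
  where "CBlinfun f = Abs_cblinfun (Blinfun f)"

lemma cblinfun_apply_CBlinfun: "bounded_clinear f \<Longrightarrow> cblinfun_apply (CBlinfun f) = f"
  by (simp add: CBlinfun_def cblinfun_apply_def bounded_clinear_def Abs_cblinfun_inverse
      bounded_linear_Blinfun_apply)

lemma bounded_clinear_cblinfun_apply: "bounded_clinear (cblinfun_apply f)"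
  unfolding bounded_clinear_def by transfer (auto intro: blinfun.bounded_linear_right)

lemma cblinfun_eqI: "(\<And>x. cblinfun_apply f x = cblinfun_apply g x) \<Longrightarrow> f = g"
  by transfer (rule blinfun_eqI)

instantiation cblinfun :: (cbanach, cbanach) real_normed_vector
begin

lift_definition norm_cblinfun :: "('a \<Rightarrow>\<^sub>C\<^sub>L 'b) \<Rightarrow> real" is norm .

lift_definition zero_cblinfun :: "'a \<Rightarrow>\<^sub>C\<^sub>L 'b" is 0 by simp

lift_definition plus_cblinfun :: "('a \<Rightarrow>\<^sub>C\<^sub>L 'b) \<Rightarrow> ('a \<Rightarrow>\<^sub>C\<^sub>L 'b) \<Rightarrow> ('a \<Rightarrow>\<^sub>C\<^sub>L 'b)" is "(+)"
  by (simp add: blinfun.add_left scaleC_add_right)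

lift_definition minus_cblinfun :: "('a \<Rightarrow>\<^sub>C\<^sub>L 'b) \<Rightarrow> ('a \<Rightarrow>\<^sub>C\<^sub>L 'b) \<Rightarrow> ('a \<Rightarrow>\<^sub>C\<^sub>L 'b)" is "(-)"
  by (simp add: blinfun.diff_left scaleC_diff_right)

lift_definition uminus_cblinfun :: "('a \<Rightarrow>\<^sub>C\<^sub>L 'b) \<Rightarrow> ('a \<Rightarrow>\<^sub>C\<^sub>L 'b)" is uminus
  by (simp add: blinfun.minus_left scaleC_minus_right)

lift_definition scaleR_cblinfun :: "real \<Rightarrow> ('a \<Rightarrow>\<^sub>C\<^sub>L 'b) \<Rightarrow> ('a \<Rightarrow>\<^sub>C\<^sub>L 'b)" is "(*\<^sub>R)"
  by (simp add: blinfun.scaleR_left scaleC_scaleR)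

definition dist_cblinfun :: "('a \<Rightarrow>\<^sub>C\<^sub>L 'b) \<Rightarrow> ('a \<Rightarrow>\<^sub>C\<^sub>L 'b) \<Rightarrow> real"
  where "dist_cblinfun f g = norm (f - g)"

definition sgn_cblinfun :: "('a \<Rightarrow>\<^sub>C\<^sub>L 'b) \<Rightarrow> ('a \<Rightarrow>\<^sub>C\<^sub>L 'b)"
  where "sgn_cblinfun f = inverse (norm f) *\<^sub>R f"

definition uniformity_cblinfun :: "(('a \<Rightarrow>\<^sub>C\<^sub>L 'b) \<times> ('a \<Rightarrow>\<^sub>C\<^sub>L 'b)) filter"
  where "uniformity_cblinfun = (INF e\<in>{0 <..}. principal {(f, g). dist f g < e})"

definition open_cblinfun :: "('a \<Rightarrow>\<^sub>C\<^sub>L 'b) set \<Rightarrow> bool"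
  where "open_cblinfun U = (\<forall>f\<in>U. \<forall>\<^sub>F (f', g) in uniformity. f' = f \<longrightarrow> g \<in> U)"

instance
  apply standard
  unfolding dist_cblinfun_def open_cblinfun_def sgn_cblinfun_def uniformity_cblinfun_def
  apply (rule refl | (transfer, force simp: norm_triangle_ineq algebra_simps))+
  done

end

lemma norm_cblinfun_eq_onorm: "norm f = onorm (cblinfun_apply f)"
  by transfer (rule norm_blinfun.rep_eq)

lemma norm_cblinfun_apply: "norm (cblinfun_apply f x) \<le> norm f * norm x"
  by transfer (rule norm_blinfun)

lemma norm_cblinfun_bound:
  "0 \<le> b \<Longrightarrow> (\<And>x. norm (cblinfun_apply f x) \<le> b * norm x) \<Longrightarrow> norm f \<le> b"
  by transfer (rule norm_blinfun_bound)

lemma cblinfun_apply_add_left [simp]: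
  "cblinfun_apply (f + g) x = cblinfun_apply f x + cblinfun_apply g x"
  by transfer (rule blinfun.add_left)

instance cblinfun :: (cbanach, cbanach) banach
proof
  fix F :: "nat \<Rightarrow> 'a \<Rightarrow>\<^sub>C\<^sub>L 'b"
  assume F: "Cauchy F"
  have dist_eq: "dist f g = dist (blinfun_of_cblinfun f) (blinfun_of_cblinfun g)" for f g :: "'a \<Rightarrow>\<^sub>C\<^sub>L 'b"
    unfolding dist_norm by transfer simp
  have "Cauchy (\<lambda>n. blinfun_of_cblinfun (F n))"
    using F unfolding Cauchy_def dist_eq .
  then obtain G where G: "(\<lambda>n. blinfun_of_cblinfun (F n)) \<longlonglongrightarrow> G"
    by (auto simp: Cauchy_convergent_iff convergent_def)
  have lim: "(\<lambda>n. blinfun_apply (blinfun_of_cblinfun (F n)) x) \<longlonglongrightarrow> blinfun_apply G x" for x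
    by (rule blinfun.tendsto[OF G tendsto_const])
  have "blinfun_apply G (a *\<^sub>C x) = a *\<^sub>C blinfun_apply G x" for a x
  proof (rule LIMSEQ_unique)
    show "(\<lambda>n. blinfun_apply (blinfun_of_cblinfun (F n)) (a *\<^sub>C x)) \<longlonglongrightarrow> blinfun_apply G (a *\<^sub>C x)"
      by (rule lim)
    show "(\<lambda>n. blinfun_apply (blinfun_of_cblinfun (F n)) (a *\<^sub>C x)) \<longlonglongrightarrow> a *\<^sub>C blinfun_apply G x"
      using bounded_linear.tendsto[OF bounded_linear_scaleC lim, of a x]
        blinfun_of_cblinfun[of "F _"] by simp
  qed
  then have "blinfun_of_cblinfun (Abs_cblinfun G) = G"
    by (simp add: Abs_cblinfun_inverse)
  then have "F \<longlonglongrightarrow> Abs_cblinfun G"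
    using G by (simp add: lim_sequentially dist_eq)
  then show "convergent F"
    by (rule convergentI)
qed

instantiation cblinfun :: (cbanach, cbanach) cbanach
begin

definition scaleC_cblinfun :: "complex \<Rightarrow> ('a \<Rightarrow>\<^sub>C\<^sub>L 'b) \<Rightarrow> ('a \<Rightarrow>\<^sub>C\<^sub>L 'b)"
  where "scaleC_cblinfun a f = CBlinfun (\<lambda>x. a *\<^sub>C cblinfun_apply f x)"

lemma cblinfun_apply_scaleC [simp]: "cblinfun_apply (a *\<^sub>C f) x = a *\<^sub>C cblinfun_apply f x"
  for f :: "'a \<Rightarrow>\<^sub>C\<^sub>L 'b"
proof -
  have "bounded_clinear (\<lambda>x. a *\<^sub>C cblinfun_apply f x)"
    using bounded_clinear_cblinfun_apply[of f] unfolding bounded_clinear_def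
    by (auto intro: bounded_linear_compose[OF bounded_linear_scaleC]
        simp: scaleC_scaleC mult.commute)
  then show ?thesis
    by (simp add: scaleC_cblinfun_def cblinfun_apply_CBlinfun)
qed

instance
proof
  fix a b :: complex and r :: real and f g :: "'a \<Rightarrow>\<^sub>C\<^sub>L 'b"
  show "a *\<^sub>C (f + g) = a *\<^sub>C f + a *\<^sub>C g"
    by (rule cblinfun_eqI) (simp add: scaleC_add_right)
  show "(a + b) *\<^sub>C f = a *\<^sub>C f + b *\<^sub>C f"
    by (rule cblinfun_eqI) (simp add: scaleC_add_left)
  show ass: "a *\<^sub>C (b *\<^sub>C f) = (a * b) *\<^sub>C f" for a b and f :: "'a \<Rightarrow>\<^sub>C\<^sub>L 'b"
    by (rule cblinfun_eqI) (simp add: scaleC_scaleC)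
  have "cblinfun_apply (r *\<^sub>R f) x = r *\<^sub>R cblinfun_apply f x" for x
    by transfer (rule blinfun.scaleR_left)
  then show "of_real r *\<^sub>C f = r *\<^sub>R f"
    by (intro cblinfun_eqI) (simp add: scaleC_of_real)
  have le: "norm (c *\<^sub>C h) \<le> cmod c * norm h" for c and h :: "'a \<Rightarrow>\<^sub>C\<^sub>L 'b"
    by (rule norm_cblinfun_bound)
      (auto simp: norm_scaleC mult.assoc intro!: mult_left_mono norm_cblinfun_apply)
  show "norm (a *\<^sub>C f) = cmod a * norm f"
  proof (cases "a = 0")
    case True
    then show ?thesis using le[of 0 f] by simp
  next
    case False
    have "inverse a *\<^sub>C (a *\<^sub>C f) = f"
      using False by (intro cblinfun_eqI) (simp add: scaleC_scaleC)
    then have "norm f \<le> cmod (inverse a) * norm (a *\<^sub>C f)"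
      using le[of "inverse a" "a *\<^sub>C f"] by simp
    then have "cmod a * norm f \<le> norm (a *\<^sub>C f)"
      using False by (simp add: norm_divide field_simps)
    with le[of a f] show ?thesis by simp
  qed
qed

end

definition cblinfun_id :: "'a :: cbanach \<Rightarrow>\<^sub>C\<^sub>L 'a"
  where "cblinfun_id = CBlinfun (\<lambda>x. x)"

definition cblinfun_compose ::
  "('b :: cbanach \<Rightarrow>\<^sub>C\<^sub>L 'c :: cbanach) \<Rightarrow> ('a :: cbanach \<Rightarrow>\<^sub>C\<^sub>L 'b) \<Rightarrow> ('a \<Rightarrow>\<^sub>C\<^sub>L 'c)"  (infixl "o\<^sub>C" 67)
  where "f o\<^sub>C g = CBlinfun (\<lambda>x. cblinfun_apply f (cblinfun_apply g x))"

lemma cblinfun_apply_id [simp]: "cblinfun_apply cblinfun_id x = x"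
  unfolding cblinfun_id_def
  by (subst cblinfun_apply_CBlinfun) (auto intro: bounded_clinearI[where K = 1])

lemma cblinfun_apply_compose [simp]:
  "cblinfun_apply (f o\<^sub>C g) x = cblinfun_apply f (cblinfun_apply g x)"
proof -
  have "bounded_clinear (\<lambda>x. cblinfun_apply f (cblinfun_apply g x))"
    using bounded_clinear_cblinfun_apply[of f] bounded_clinear_cblinfun_apply[of g]
    by (simp add: bounded_clinear_def bounded_linear_compose)
  then show ?thesis
    by (simp add: cblinfun_compose_def cblinfun_apply_CBlinfun)
qed

lemma norm_cblinfun_compose: "norm (f o\<^sub>C g) \<le> norm f * norm g"
proof (rule norm_cblinfun_bound)
  fix x
  have "norm (cblinfun_apply f (cblinfun_apply g x)) \<le> norm f * norm (cblinfun_apply g x)"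
    by (rule norm_cblinfun_apply)
  also have "\<dots> \<le> norm f * (norm g * norm x)"
    by (intro mult_left_mono norm_cblinfun_apply norm_ge_zero)
  finally show "norm (cblinfun_apply (f o\<^sub>C g) x) \<le> norm f * norm g * norm x"
    by (simp add: mult.assoc)
qed simp


section \<open>Dual spaces, adjoints, reflexivity\<close>

type_synonym 'a dual = "('a, complex) cblinfun"

definition cadjoint :: "('a :: cbanach \<Rightarrow>\<^sub>C\<^sub>L 'b :: cbanach) \<Rightarrow> ('b dual \<Rightarrow>\<^sub>C\<^sub>L 'a dual)"
  where "cadjoint T = CBlinfun (\<lambda>\<phi>. \<phi> o\<^sub>C T)"

lemma cblinfun_apply_cadjoint [simp]: "cblinfun_apply (cadjoint T) \<phi> = \<phi> o\<^sub>C T"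
proof -
  have "bounded_clinear (\<lambda>\<phi> :: 'b dual. \<phi> o\<^sub>C T)"
    by (rule bounded_clinearI[OF _ _ norm_cblinfun_compose]) (auto intro!: cblinfun_eqI)
  then show ?thesis
    by (simp add: cadjoint_def cblinfun_apply_CBlinfun)
qed

definition dual_eval :: "'a :: cbanach \<Rightarrow> 'a dual dual"
  where "dual_eval x = CBlinfun (\<lambda>\<phi>. cblinfun_apply \<phi> x)"

lemma cblinfun_apply_dual_eval [simp]: "cblinfun_apply (dual_eval x) \<phi> = cblinfun_apply \<phi> x"
proof -
  have "bounded_clinear (\<lambda>\<phi> :: 'a dual. cblinfun_apply \<phi> x)"
    by (rule bounded_clinearI[OF _ _ norm_cblinfun_apply]) auto
  then show ?thesis
    by (simp add: dual_eval_def cblinfun_apply_CBlinfun)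
qed

definition reflexive_space :: "'a :: cbanach itself \<Rightarrow> bool"
  where "reflexive_space _ \<longleftrightarrow> surj (dual_eval :: 'a \<Rightarrow> 'a dual dual)"


section \<open>Hermitian operators and Moore-Penrose inverses\<close>

text \<open>The library's \<open>exp\<close> needs a real normed algebra whose unit has norm 1, which fails for the
  operators on the zero space; hence the exponential series is written out here.\<close>

definition cblinfun_exp :: "('a :: cbanach \<Rightarrow>\<^sub>C\<^sub>L 'a) \<Rightarrow> ('a \<Rightarrow>\<^sub>C\<^sub>L 'a)"
  where "cblinfun_exp A = (\<Sum>n. inverse (fact n) *\<^sub>R (((o\<^sub>C) A ^^ n) cblinfun_id))"

definition hermitian :: "('a :: cbanach \<Rightarrow>\<^sub>C\<^sub>L 'a) \<Rightarrow> bool"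
  where "hermitian H \<longleftrightarrow> (\<forall>t :: real. norm (cblinfun_exp ((\<i> * of_real t) *\<^sub>C H)) = 1)"

definition is_mp_inverse :: "('a :: cbanach \<Rightarrow>\<^sub>C\<^sub>L 'a) \<Rightarrow> ('a \<Rightarrow>\<^sub>C\<^sub>L 'a) \<Rightarrow> bool"
  where "is_mp_inverse T S \<longleftrightarrow>
    T = T o\<^sub>C S o\<^sub>C T \<and> S = S o\<^sub>C T o\<^sub>C S \<and> hermitian (T o\<^sub>C S) \<and> hermitian (S o\<^sub>C T)"

definition mp_invertible :: "('a :: cbanach \<Rightarrow>\<^sub>C\<^sub>L 'a) \<Rightarrow> bool"
  where "mp_invertible T \<longleftrightarrow> (\<exists>S. is_mp_inverse T S)"

text \<open>Moore-Penrose inverses are unique, so this is the Moore-Penrose inverse of \<open>T\<close> whenever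
  \<open>mp_invertible T\<close> holds; otherwise it is an unspecified operator.\<close>

definition mp_inverse :: "('a :: cbanach \<Rightarrow>\<^sub>C\<^sub>L 'a) \<Rightarrow> ('a \<Rightarrow>\<^sub>C\<^sub>L 'a)"
  where "mp_inverse T = (THE S. is_mp_inverse T S)"

end

theory Submission
  imports Defs
begin

text \<open>The adjoint is an isometric anti-homomorphism of operator algebras (isometric by Hahn--Banach),
  so it commutes with the exponential and preserves and reflects hermitian operators; hence \<open>S\<close> is a
  Moore-Penrose inverse of \<open>T\<close> iff the adjoint of \<open>S\<close> is one of the adjoint of \<open>T\<close>. Uniqueness of
  Moore-Penrose inverses reduces to the fact that two hermitian idempotents \<open>e\<close>, \<open>f\<close> with the same
  range (or the same kernel) agree: \<open>exp (i\<pi>e) = 1 - 2e\<close> and \<open>1 - 2f\<close> are contractions, their product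
  is \<open>1 - 2(e - f)\<close> (or \<open>1 + 2(e - f)\<close>) with \<open>(e - f)\<^sup>2 = 0\<close>, and the powers of \<open>1 + n\<close> with
  \<open>n\<^sup>2 = 0\<close> are bounded only if \<open>n = 0\<close>. On a reflexive space every operator on the dual is an adjoint.\<close>

section \<open>The Hahn--Banach theorem\<close>

text \<open>Dominated extension is replaced by minimal sublinear functionals, which are linear;
  this needs no subspaces.\<close>

definition sublinear :: "('a :: real_vector \<Rightarrow> real) \<Rightarrow> bool"
  where "sublinear q \<longleftrightarrow>
    (\<forall>x y. q (x + y) \<le> q x + q y) \<and> (\<forall>r x. 0 < r \<longrightarrow> q (r *\<^sub>R x) \<le> r * q x)"

lemma sublinear_add: "sublinear q \<Longrightarrow> q (x + y) \<le> q x + q y"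
  by (simp add: sublinear_def)

lemma sublinear_scaleR:
  assumes "sublinear q" "0 < r"
  shows "q (r *\<^sub>R x) = r * q x"
proof (rule antisym)
  show "q (r *\<^sub>R x) \<le> r * q x"
    using assms by (simp add: sublinear_def)
  have "q (inverse r *\<^sub>R r *\<^sub>R x) \<le> inverse r * q (r *\<^sub>R x)"
    using assms unfolding sublinear_def by (metis positive_imp_inverse_positive)
  then show "r * q x \<le> q (r *\<^sub>R x)"
    using assms by (simp add: field_simps)
qed

lemma sublinear_zero: "sublinear q \<Longrightarrow> q 0 = 0"
  using sublinear_scaleR[of q 2 0] by simp

lemma sublinear_neg_le: "sublinear q \<Longrightarrow> - q (- x) \<le> q x"
  using sublinear_add[of q x "- x"] sublinear_zero[of q] by simp

text \<open>Built for sublinear \<open>q\<close> so that a linear functional below the tilt is below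
  \<open>q\<close> (take \<open>t = 0\<close>) and at least \<open>q y\<close> at \<open>y\<close>
  (take \<open>t = 1\<close> at the point \<open>- y\<close>). The infimum over all
  \<open>t \<ge> 0\<close> keeps the result sublinear.\<close>

definition sublinear_tilt :: "('a :: real_vector \<Rightarrow> real) \<Rightarrow> 'a \<Rightarrow> 'a \<Rightarrow> real"
  where "sublinear_tilt q y x = (INF t\<in>{0..}. q (x + t *\<^sub>R y) - t * q y)"

lemma sublinear_tilt_le:
  assumes "sublinear q" "0 \<le> t"
  shows "sublinear_tilt q y x \<le> q (x + t *\<^sub>R y) - t * q y"
  unfolding sublinear_tilt_def
proof (rule cINF_lower)
  \<comment> \<open>A lower bound independent of \<open>s\<close>: split
    \<open>s *\<^sub>R y\<close> as \<open>(x + s *\<^sub>R y) + (- x)\<close> and use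
    subadditivity.\<close>
  have "- q (- x) \<le> q (x + s *\<^sub>R y) - s * q y" if "0 \<le> s" for s
  proof -
    have "q (s *\<^sub>R y) = s * q y"
      using that sublinear_scaleR[OF assms(1), of s y] sublinear_zero[OF assms(1)]
      by (cases "s = 0") auto
    then show ?thesis
      using sublinear_add[OF assms(1), of "x + s *\<^sub>R y" "- x"] by simp
  qed
  then show "bdd_below ((\<lambda>t. q (x + t *\<^sub>R y) - t * q y) ` {0..})"
    by (auto intro!: bdd_belowI)
qed (use assms in simp)

lemma sublinear_tilt_le_self: "sublinear q \<Longrightarrow> sublinear_tilt q y x \<le> q x"
  using sublinear_tilt_le[of q 0 y x] by simp

lemma sublinear_tilt_greatest:
  "(\<And>t. 0 \<le> t \<Longrightarrow> b \<le> q (x + t *\<^sub>R y) - t * q y) \<Longrightarrow> b \<le> sublinear_tilt q y x"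
  unfolding sublinear_tilt_def by (rule cINF_greatest) auto

text \<open>The parameter of the infimum absorbs both operations: \<open>s\<close> for
  \<open>x\<close> and \<open>t\<close> for \<open>x'\<close> combine to \<open>s + t\<close> for
  the sum, and \<open>t\<close> for \<open>x\<close> becomes \<open>r * t\<close> for
  \<open>r *\<^sub>R x\<close>.\<close>

lemma sublinear_sublinear_tilt:
  assumes q: "sublinear q"
  shows "sublinear (sublinear_tilt q y)"
proof -
  have add: "sublinear_tilt q y (x + x') \<le> sublinear_tilt q y x + sublinear_tilt q y x'" for x x'
  proof -
    have *: "sublinear_tilt q y (x + x') \<le>
        (q (x + s *\<^sub>R y) - s * q y) + (q (x' + t *\<^sub>R y) - t * q y)" if "0 \<le> s" "0 \<le> t" for s t
      using sublinear_tilt_le[OF q, of "s + t" y "x + x'"] that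
        sublinear_add[OF q, of "x + s *\<^sub>R y" "x' + t *\<^sub>R y"]
      by (simp add: algebra_simps)
    have "sublinear_tilt q y (x + x') - sublinear_tilt q y x' \<le> sublinear_tilt q y x"
    proof (rule sublinear_tilt_greatest)
      fix s :: real assume s: "0 \<le> s"
      have "sublinear_tilt q y (x + x') - (q (x + s *\<^sub>R y) - s * q y) \<le> sublinear_tilt q y x'"
        by (rule sublinear_tilt_greatest) (use *[OF s] in \<open>simp add: algebra_simps\<close>)
      then show "sublinear_tilt q y (x + x') - sublinear_tilt q y x' \<le> q (x + s *\<^sub>R y) - s * q y"
        by simp
    qed
    then show ?thesis by simp
  qed
  have scale: "sublinear_tilt q y (r *\<^sub>R x) \<le> r * sublinear_tilt q y x" if r: "0 < r" for r x
  proof -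
    have "sublinear_tilt q y (r *\<^sub>R x) / r \<le> sublinear_tilt q y x"
    proof (rule sublinear_tilt_greatest)
      fix t :: real assume t: "0 \<le> t"
      have "sublinear_tilt q y (r *\<^sub>R x) \<le> q (r *\<^sub>R (x + t *\<^sub>R y)) - (r * t) * q y"
        using sublinear_tilt_le[OF q, of "r * t" y "r *\<^sub>R x"] r t
        by (simp add: scaleR_add_right)
      then show "sublinear_tilt q y (r *\<^sub>R x) / r \<le> q (x + t *\<^sub>R y) - t * q y"
        using r unfolding sublinear_scaleR[OF q r] by (simp add: field_simps)
    qed
    then show ?thesis using r by (simp add: field_simps)
  qed
  show ?thesis
    using add scale by (simp add: sublinear_def)
qed

text \<open>Zorn's lemma on the sublinear functionals below \<open>p\<close>. A nonempty chain is
  bounded below by its pointwise infimum, which is finite because every member is at least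
  \<open>- p (- x)\<close> at \<open>x\<close>.\<close>

lemma minimal_sublinear_exists:
  fixes p :: "'a :: real_vector \<Rightarrow> real"
  assumes p: "sublinear p"
  shows "\<exists>q. sublinear q \<and> q \<le> p \<and> (\<forall>r. sublinear r \<and> r \<le> q \<longrightarrow> r = q)"
proof -
  define A where "A = {q. sublinear q \<and> q \<le> p}"
  \<comment> \<open>The order is reversed: \<open>predicate_Zorn\<close> yields maximal elements,
    and minimal ones are wanted.\<close>
  define P where "P = (\<lambda>f g :: 'a \<Rightarrow> real. g \<le> f)"
  have "\<exists>m\<in>A. \<forall>a\<in>A. P m a \<longrightarrow> a = m"
  proof (rule predicate_Zorn)
    show "partial_order_on A (relation_of P A)"
      by (rule partial_order_on_relation_ofI) (auto simp: P_def)
  next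
    fix C assume C: "C \<in> Chains (relation_of P A)"
    then have CA: "sublinear q" "q \<le> p" if "q \<in> C" for q
      using that by (auto simp: Chains_def relation_of_def A_def)
    have tot: "f \<le> g \<or> g \<le> f" if "f \<in> C" "g \<in> C" for f g
      using that C by (auto simp: Chains_def relation_of_def P_def)
    show "\<exists>u\<in>A. \<forall>a\<in>C. P a u"
    proof (cases "C = {}")
      case True
      then show ?thesis using p by (auto simp: A_def)
    next
      case ne: False
      define u where "u x = (INF q\<in>C. q x)" for x
      have low: "u x \<le> q x" if "q \<in> C" for q x
        unfolding u_def
      proof (rule cINF_lower[OF _ that])
        have "- p (- x) \<le> f x" if "f \<in> C" for f
          using sublinear_neg_le[OF CA(1)[OF that], of x] le_funD[OF CA(2)[OF that], of "- x"]
          by simp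
        then show "bdd_below ((\<lambda>q. q x) ` C)"
          by (auto intro!: bdd_belowI)
      qed
      have great: "b \<le> u x" if "\<And>q. q \<in> C \<Longrightarrow> b \<le> q x" for b x
        unfolding u_def using ne that by (rule cINF_greatest)
      have "u (x + y) \<le> u x + u y" for x y
      proof -
        \<comment> \<open>The smaller of the two chain members, evaluated at \<open>x + y\<close>,
          suffices, since it lies below the other one at either argument.\<close>
        have *: "u (x + y) \<le> f x + g y" if fg: "f \<in> C" "g \<in> C" for f g
          using tot[OF fg]
        proof
          assume "f \<le> g"
          then show ?thesis
            using low[OF fg(1), of "x + y"] sublinear_add[OF CA(1)[OF fg(1)], of x y]
              le_funD[of f g y] by simp
        next
          assume "g \<le> f"
          then show ?thesis
            using low[OF fg(2), of "x + y"] sublinear_add[OF CA(1)[OF fg(2)], of x y]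
              le_funD[of g f x] by simp
        qed
        have "u (x + y) - u y \<le> u x"
        proof (rule great)
          fix f assume f: "f \<in> C"
          have "u (x + y) - f x \<le> u y"
            by (rule great) (use *[OF f] in \<open>simp add: algebra_simps\<close>)
          then show "u (x + y) - u y \<le> f x" by simp
        qed
        then show ?thesis by simp
      qed
      moreover have "u (r *\<^sub>R x) \<le> r * u x" if r: "0 < r" for r x
      proof -
        have "u (r *\<^sub>R x) / r \<le> u x"
        proof (rule great)
          fix f assume f: "f \<in> C"
          show "u (r *\<^sub>R x) / r \<le> f x"
            using low[OF f, of "r *\<^sub>R x"] sublinear_scaleR[OF CA(1)[OF f] r] r
            by (simp add: field_simps)
        qed
        then show ?thesis using r by (simp add: field_simps)
      qed
      ultimately have "sublinear u"
        by (simp add: sublinear_def)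
      moreover have "u \<le> p"
        using ne low CA(2) by (meson all_not_in_conv le_funI le_funD order_trans)
      ultimately show ?thesis
        using low by (auto simp: A_def P_def le_fun_def)
    qed
  qed
  then show ?thesis
    unfolding A_def P_def by (metis (mono_tags, lifting) mem_Collect_eq order_trans)
qed

text \<open>A minimal \<open>q\<close> equals each of its tilts, as these are sublinear and below
  it; the tilt inequality at \<open>t = 1\<close> then makes \<open>q\<close> superadditive, hence
  additive.\<close>

lemma linear_le_sublinear_exists:
  fixes p :: "'a :: real_vector \<Rightarrow> real"
  assumes "sublinear p"
  shows "\<exists>f. linear f \<and> (\<forall>x. f x \<le> p x)"
proof -
  obtain q where q: "sublinear q" "q \<le> p" and min: "\<And>r. sublinear r \<Longrightarrow> r \<le> q \<Longrightarrow> r = q"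
    using minimal_sublinear_exists[OF assms] by blast
  have add: "q (x + y) = q x + q y" for x y
  proof (rule antisym)
    have "sublinear_tilt q y = q"
      using q(1) by (intro min sublinear_sublinear_tilt le_funI sublinear_tilt_le_self)
    then show "q x + q y \<le> q (x + y)"
      using sublinear_tilt_le[OF q(1), of 1 y x] by simp
  qed (rule sublinear_add[OF q(1)])
  have minus: "q (- x) = - q x" for x
    using add[of x "- x"] sublinear_zero[OF q(1)] by simp
  have "q (r *\<^sub>R x) = r *\<^sub>R q x" for r x
  proof (cases r "0 :: real" rule: linorder_cases)
    case less
    then show ?thesis
      using sublinear_scaleR[OF q(1), of "- r" x] minus[of "r *\<^sub>R x"] by simp
  next
    case equal
    then show ?thesis using sublinear_zero[OF q(1)] by simp
  next
    case greater
    then show ?thesis using sublinear_scaleR[OF q(1)] by simp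
  qed
  then have "linear q"
    using add by (intro linearI) auto
  then show ?thesis
    using q(2) by (auto simp: le_fun_def)
qed

text \<open>A linear functional below the norm tilted by \<open>x\<close> takes at
  \<open>- x\<close> a value of at most \<open>norm (- x + x) - norm x\<close>.\<close>

lemma real_norming_functional_exists:
  fixes x :: "'a :: real_normed_vector"
  shows "\<exists>f :: 'a \<Rightarrow> real. linear f \<and> (\<forall>y. f y \<le> norm y) \<and> norm x \<le> f x"
proof -
  have n: "sublinear (norm :: 'a \<Rightarrow> real)"
    by (simp add: sublinear_def norm_triangle_ineq)
  obtain f where f: "linear f" "\<And>y. f y \<le> sublinear_tilt norm x y"
    using linear_le_sublinear_exists[OF sublinear_sublinear_tilt[OF n, of x]] by blast
  have "f (- x) \<le> - norm x"
    using f(2)[of "- x"] sublinear_tilt_le[OF n, of 1 x "- x"] by simp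
  then have "norm x \<le> f x"
    using linear_neg[OF f(1), of x] by simp
  moreover have "f y \<le> norm y" for y
    using f(2)[of y] sublinear_tilt_le_self[OF n, of x y] by simp
  ultimately show ?thesis
    using f(1) by blast
qed

section \<open>Complex norming functionals\<close>

lemma scaleC_minus_left: "(- a) *\<^sub>C x = - (a *\<^sub>C x)" for x :: "'a :: cbanach"
  using scaleC_scaleC[of a "-1" x] scaleC_of_real[of "-1" x] by (simp add: scaleC_minus_right)

text \<open>Complexification: a real norming functional \<open>f\<close> is the real part of the
  complex-linear functional sending \<open>y\<close> to
  \<open>f y - \<i> * f (\<i> *\<^sub>C y)\<close>, and a rotation shows that this one is bounded by
  the norm too.\<close>

lemma norming_functional_exists:
  fixes x :: "'a :: cbanach"
  shows "\<exists>\<phi> :: 'a dual. norm \<phi> \<le> 1 \<and> norm x \<le> cmod (cblinfun_apply \<phi> x)"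
proof -
  obtain f :: "'a \<Rightarrow> real" where f: "linear f" "\<And>y. f y \<le> norm y" "norm x \<le> f x"
    using real_norming_functional_exists[of x] by blast
  define g where "g y = Complex (f y) (- f (\<i> *\<^sub>C y))" for y
  have g_add: "g (y + z) = g y + g z" for y z
    by (simp add: g_def complex_eq_iff scaleC_add_right linear_add[OF f(1)])
  have g_scale: "g (a *\<^sub>C y) = a * g y" for a y
  proof -
    have split: "a *\<^sub>C z = Re a *\<^sub>R z + Im a *\<^sub>R (\<i> *\<^sub>C z)" for z :: 'a
    proof -
      have "a *\<^sub>C z = (of_real (Re a) + of_real (Im a) * \<i>) *\<^sub>C z"
        using complex_eq[of a] by (simp add: mult.commute)
      also have "\<dots> = Re a *\<^sub>R z + Im a *\<^sub>R (\<i> *\<^sub>C z)"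
        by (simp add: scaleC_add_left scaleC_of_real flip: scaleC_scaleC)
      finally show ?thesis .
    qed
    have ii: "\<i> *\<^sub>C \<i> *\<^sub>C y = - y"
      by (simp add: scaleC_scaleC scaleC_minus_left)
    have "f (\<i> *\<^sub>C a *\<^sub>C y) = Re a * f (\<i> *\<^sub>C y) - Im a * f y"
      by (simp add: split scaleC_add_right scaleC_scaleR ii linear_add[OF f(1)]
          linear_diff[OF f(1)] linear_neg[OF f(1)] linear_scale[OF f(1)])
    then show ?thesis
      by (simp add: g_def complex_eq_iff split[of y] linear_add[OF f(1)] linear_scale[OF f(1)])
  qed
  have g_norm: "cmod (g y) \<le> norm y" for y
  proof (cases "g y = 0")
    case False
    \<comment> \<open>A unimodular factor that makes \<open>g (c *\<^sub>C y)\<close> real and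
      nonnegative, so that it equals its real part \<open>f (c *\<^sub>C y)\<close>.\<close>
    define c where "c = cnj (g y) / cmod (g y)"
    have "cmod c = 1"
      using False by (simp add: c_def norm_divide)
    have "c * g y = cmod (g y)"
      using False by (simp add: c_def complex_norm_square[symmetric] mult.commute power2_eq_square)
    then have "g (c *\<^sub>C y) = cmod (g y)"
      by (simp add: g_scale)
    then have "cmod (g y) = f (c *\<^sub>C y)"
      by (metis g_def complex.sel(1) Re_complex_of_real)
    also have "\<dots> \<le> norm y"
      using f(2)[of "c *\<^sub>C y"] \<open>cmod c = 1\<close> by (simp add: norm_scaleC)
    finally show ?thesis .
  qed simp
  have app: "cblinfun_apply (CBlinfun g) = g"
    by (rule cblinfun_apply_CBlinfun, rule bounded_clinearI[where K = 1])
      (simp_all add: g_add g_scale g_norm scaleC_complex_def)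
  have "norm (CBlinfun g) \<le> 1"
    by (rule norm_cblinfun_bound) (simp_all add: app g_norm)
  moreover have "norm x \<le> cmod (g x)"
    using f(3) complex_Re_le_cmod[of "g x"] by (simp add: g_def)
  ultimately show ?thesis
    using app by metis
qed


section \<open>Adjoints\<close>

lemma cblinfun_apply_scaleR [simp]: "cblinfun_apply (r *\<^sub>R f) x = r *\<^sub>R cblinfun_apply f x"
  by (metis cblinfun_apply_scaleC scaleC_of_real)

lemma cblinfun_apply_zero [simp]: "cblinfun_apply 0 x = 0"
  using cblinfun_apply_scaleR[of 0 0 x] by simp

lemma cblinfun_apply_diff [simp]:
  "cblinfun_apply (f - g) x = cblinfun_apply f x - cblinfun_apply g x"
  using cblinfun_apply_add_left[of "f - g" g x] by (simp add: eq_diff_eq)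

lemma linear_cblinfun_apply: "linear (cblinfun_apply f)"
  using bounded_clinear_cblinfun_apply[of f] bounded_linear.linear
  by (auto simp: bounded_clinear_def)

lemmas cblinfun_apply_linear =
  linear_add[OF linear_cblinfun_apply] linear_diff[OF linear_cblinfun_apply]
  linear_0[OF linear_cblinfun_apply] linear_scale[OF linear_cblinfun_apply]

lemma cblinfun_apply_scaleC_right: "cblinfun_apply f (a *\<^sub>C x) = a *\<^sub>C cblinfun_apply f x"
  using bounded_clinear_cblinfun_apply[of f] by (simp add: bounded_clinear_def)

lemma cblinfun_compose_assoc: "f o\<^sub>C g o\<^sub>C h = f o\<^sub>C (g o\<^sub>C h)"
  by (rule cblinfun_eqI) simp

lemma cadjoint_add: "cadjoint (A + B) = cadjoint A + cadjoint B"
  by (intro cblinfun_eqI) (simp add: cblinfun_apply_linear)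

lemma cadjoint_scaleC: "cadjoint (a *\<^sub>C A) = a *\<^sub>C cadjoint A"
  by (intro cblinfun_eqI) (simp add: cblinfun_apply_scaleC_right)

lemma cadjoint_scaleR: "cadjoint (r *\<^sub>R A) = r *\<^sub>R cadjoint A"
  by (metis cadjoint_scaleC scaleC_of_real)

lemma cadjoint_compose: "cadjoint (A o\<^sub>C B) = cadjoint B o\<^sub>C cadjoint A"
  by (intro cblinfun_eqI) simp

lemma cadjoint_id: "cadjoint cblinfun_id = cblinfun_id"
  by (intro cblinfun_eqI) simp

text \<open>One inequality is submultiplicativity of the norm. For the other, a functional norming
  the image of \<open>x\<close> under \<open>A\<close> is pulled back along
  \<open>A\<close>.\<close>

lemma norm_cadjoint: "norm (cadjoint A) = norm A"
proof (rule antisym)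
  show "norm (cadjoint A) \<le> norm A"
    by (rule norm_cblinfun_bound) (simp_all add: mult.commute[of "norm A"] norm_cblinfun_compose)
  show "norm A \<le> norm (cadjoint A)"
  proof (rule norm_cblinfun_bound)
    fix x
    obtain \<phi> where \<phi>: "norm \<phi> \<le> 1"
      "norm (cblinfun_apply A x) \<le> cmod (cblinfun_apply \<phi> (cblinfun_apply A x))"
      using norming_functional_exists by blast
    note \<phi>(2)
    also have "cmod (cblinfun_apply \<phi> (cblinfun_apply A x)) \<le> norm (\<phi> o\<^sub>C A) * norm x"
      using norm_cblinfun_apply[of "\<phi> o\<^sub>C A" x] by simp
    also have "norm (\<phi> o\<^sub>C A) \<le> norm (cadjoint A) * norm \<phi>"
      using norm_cblinfun_apply[of "cadjoint A" \<phi>] by simp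
    also have "\<dots> \<le> norm (cadjoint A) * 1"
      using \<phi>(1) by (intro mult_left_mono) auto
    finally show "norm (cblinfun_apply A x) \<le> norm (cadjoint A) * norm x"
      by (simp add: mult_right_mono)
  qed simp
qed

lemma bounded_linear_cadjoint: "bounded_linear cadjoint"
  by (rule bounded_linear_intro[where K = 1])
    (simp_all add: cadjoint_add cadjoint_scaleR norm_cadjoint)

lemma cadjoint_inject: "cadjoint A = cadjoint B \<longleftrightarrow> A = B"
proof
  assume "cadjoint A = cadjoint B"
  then have "cadjoint (A - B) = 0"
    by (simp add: linear_diff[OF bounded_linear.linear[OF bounded_linear_cadjoint]])
  then show "A = B"
    using norm_cadjoint[of "A - B"] by simp
qed simp

section \<open>The canonical embedding into the bidual, and reflexivity\<close>

lemma dual_eval_add: "dual_eval (x + y) = dual_eval x + dual_eval y"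
  by (rule cblinfun_eqI) (simp add: cblinfun_apply_linear)

lemma dual_eval_scaleC: "dual_eval (a *\<^sub>C x) = a *\<^sub>C dual_eval x"
  by (rule cblinfun_eqI) (simp add: cblinfun_apply_scaleC_right)

lemma norm_dual_eval: "norm (dual_eval x) = norm x"
proof (rule antisym)
  show "norm (dual_eval x) \<le> norm x"
    by (rule norm_cblinfun_bound) (simp_all add: mult.commute[of "norm x"] norm_cblinfun_apply)
  obtain \<phi> :: "'a dual" where \<phi>: "norm \<phi> \<le> 1" "norm x \<le> cmod (cblinfun_apply \<phi> x)"
    using norming_functional_exists by blast
  note \<phi>(2)
  also have "cmod (cblinfun_apply \<phi> x) \<le> norm (dual_eval x) * norm \<phi>"
    using norm_cblinfun_apply[of "dual_eval x" \<phi>] by simp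
  also have "\<dots> \<le> norm (dual_eval x) * 1"
    using \<phi>(1) by (intro mult_left_mono) auto
  finally show "norm x \<le> norm (dual_eval x)" by simp
qed

lemma inj_dual_eval: "inj dual_eval"
proof (rule injI)
  fix x y :: 'a
  assume "dual_eval x = dual_eval y"
  moreover have "dual_eval (x - y) = dual_eval x - dual_eval y"
    by (rule cblinfun_eqI) (simp add: cblinfun_apply_linear)
  ultimately show "x = y"
    using norm_dual_eval[of "x - y"] by simp
qed

text \<open>The adjoint of \<open>R\<close>, restricted to the canonical copy of \<open>'b\<close>
  in its bidual, sends \<open>dual_eval x\<close> to \<open>dual_eval x o\<^sub>C R\<close>;
  reflexivity identifies this with a vector of \<open>'a\<close>.\<close>

lemma reflexive_imp_surj_cadjoint:
  fixes R :: "'a :: cbanach dual \<Rightarrow>\<^sub>C\<^sub>L 'b :: cbanach dual"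
  assumes "reflexive_space TYPE('a)"
  shows "\<exists>S :: 'b \<Rightarrow>\<^sub>C\<^sub>L 'a. cadjoint S = R"
proof -
  have surj: "surj (dual_eval :: 'a \<Rightarrow> 'a dual dual)"
    using assms by (simp add: reflexive_space_def)
  define s where "s x = inv dual_eval (dual_eval x o\<^sub>C R)" for x
  have s: "dual_eval (s x) = dual_eval x o\<^sub>C R" for x
    by (simp add: s_def surj_f_inv_f[OF surj])
  \<comment> \<open>Linearity and the norm bound are checked after embedding into the bidual,
    \<open>dual_eval\<close> being injective and isometric.\<close>
  have "bounded_clinear s"
  proof (rule bounded_clinearI[where K = "norm R"])
    show "s (x + y) = s x + s y" for x y
      by (rule injD[OF inj_dual_eval], rule cblinfun_eqI) (simp add: s dual_eval_add)
    show "s (a *\<^sub>C x) = a *\<^sub>C s x" for a x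
      by (rule injD[OF inj_dual_eval], rule cblinfun_eqI) (simp add: s dual_eval_scaleC)
    show "norm (s x) \<le> norm x * norm R" for x
      using norm_cblinfun_compose[of "dual_eval x" R] by (simp add: norm_dual_eval flip: s)
  qed
  then have app: "cblinfun_apply (CBlinfun s) = s"
    by (rule cblinfun_apply_CBlinfun)
  have "cblinfun_apply \<phi> (s x) = cblinfun_apply (cblinfun_apply R \<phi>) x" for \<phi> x
    using arg_cong[OF s[of x], of "\<lambda>F. cblinfun_apply F \<phi>"] by simp
  then have "cadjoint (CBlinfun s) = R"
    by (intro cblinfun_eqI) (simp add: app)
  then show ?thesis ..
qed


section \<open>Exponentials and hermitian operators\<close>

lemma norm_cblinfun_id_le: "norm (cblinfun_id :: 'a :: cbanach \<Rightarrow>\<^sub>C\<^sub>L 'a) \<le> 1"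
  by (rule norm_cblinfun_bound) auto

lemma norm_cblinfun_power_le:
  fixes A :: "'a :: cbanach \<Rightarrow>\<^sub>C\<^sub>L 'a"
  shows "norm (((o\<^sub>C) A ^^ n) cblinfun_id) \<le> norm A ^ n"
proof (induction n)
  case 0
  show ?case by (simp add: norm_cblinfun_id_le)
next
  case (Suc n)
  have "norm (A o\<^sub>C ((o\<^sub>C) A ^^ n) cblinfun_id) \<le> norm A * norm (((o\<^sub>C) A ^^ n) cblinfun_id)"
    by (rule norm_cblinfun_compose)
  also have "\<dots> \<le> norm A * norm A ^ n"
    by (intro mult_left_mono Suc.IH) auto
  finally show ?case by simp
qed

lemma summable_cblinfun_exp:
  fixes A :: "'a :: cbanach \<Rightarrow>\<^sub>C\<^sub>L 'a"
  shows "summable (\<lambda>n. inverse (fact n) *\<^sub>R (((o\<^sub>C) A ^^ n) cblinfun_id))"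
proof (rule summable_comparison_test'[OF summable_exp[of "norm A"]])
  fix n :: nat
  show "norm (inverse (fact n) *\<^sub>R (((o\<^sub>C) A ^^ n) cblinfun_id)) \<le> inverse (fact n) * norm A ^ n"
    by (simp add: mult_left_mono norm_cblinfun_power_le)
qed

text \<open>Serves \<open>cadjoint_power\<close>: the adjoint reverses products, so the factor split
  off a power returns on the other side.\<close>

lemma cblinfun_power_commute:
  fixes A :: "'a :: cbanach \<Rightarrow>\<^sub>C\<^sub>L 'a"
  shows "((o\<^sub>C) A ^^ n) cblinfun_id o\<^sub>C A = A o\<^sub>C ((o\<^sub>C) A ^^ n) cblinfun_id"
proof (induction n)
  case 0
  show ?case by (rule cblinfun_eqI) simp
qed (simp add: cblinfun_compose_assoc)

lemma cadjoint_power: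
  fixes A :: "'a :: cbanach \<Rightarrow>\<^sub>C\<^sub>L 'a"
  shows "cadjoint (((o\<^sub>C) A ^^ n) cblinfun_id) = ((o\<^sub>C) (cadjoint A) ^^ n) cblinfun_id"
  by (induction n) (simp_all add: cadjoint_id cadjoint_compose cblinfun_power_commute)

lemma cadjoint_exp: "cadjoint (cblinfun_exp A) = cblinfun_exp (cadjoint A)"
  unfolding cblinfun_exp_def bounded_linear.suminf[OF bounded_linear_cadjoint summable_cblinfun_exp]
  by (simp add: cadjoint_scaleR cadjoint_power)

lemma hermitian_cadjoint_iff: "hermitian (cadjoint H) \<longleftrightarrow> hermitian H"
  by (simp add: hermitian_def norm_cadjoint flip: cadjoint_scaleC cadjoint_exp)

section \<open>Exponentials of idempotents and reflections\<close>

lemma bounded_linear_scaleC_left: "bounded_linear (\<lambda>a. a *\<^sub>C x)" for x :: "'a :: cbanach"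
proof (rule bounded_linear_intro[where K = "norm x"])
  show "(r *\<^sub>R a) *\<^sub>C x = r *\<^sub>R (a *\<^sub>C x)" for r a
    unfolding scaleR_conv_of_real scaleC_scaleC[symmetric] scaleC_of_real ..
qed (simp_all add: scaleC_add_left norm_scaleC)

lemma cblinfun_exp_idempotent:
  fixes e :: "'a :: cbanach \<Rightarrow>\<^sub>C\<^sub>L 'a"
  assumes "e o\<^sub>C e = e"
  shows "cblinfun_exp (a *\<^sub>C e) = exp a *\<^sub>C e + (cblinfun_id - e)"
proof -
  have ee: "cblinfun_apply e (cblinfun_apply e x) = cblinfun_apply e x" for x
    using arg_cong[OF assms, of "\<lambda>f. cblinfun_apply f x"] by simp
  have pow: "((o\<^sub>C) (a *\<^sub>C e) ^^ Suc n) cblinfun_id = a ^ Suc n *\<^sub>C e" for n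
  proof (induction n)
    case 0
    show ?case by (rule cblinfun_eqI) simp
  next
    case (Suc n)
    have "((o\<^sub>C) (a *\<^sub>C e) ^^ Suc (Suc n)) cblinfun_id = (a *\<^sub>C e) o\<^sub>C (a ^ Suc n *\<^sub>C e)"
      by (simp only: funpow.simps(2) o_apply Suc.IH[symmetric])
    also have "\<dots> = a ^ Suc (Suc n) *\<^sub>C e"
      by (rule cblinfun_eqI) (simp add: cblinfun_apply_scaleC_right ee scaleC_scaleC mult.assoc power_commutes)
    finally show ?case .
  qed
  \<comment> \<open>The zeroth term is \<open>cblinfun_id\<close>, written as
    \<open>e + (cblinfun_id - e)\<close> so that \<open>e\<close> completes the scalar exponential
    series.\<close>
  have term_eq: "inverse (fact n) *\<^sub>R (((o\<^sub>C) (a *\<^sub>C e) ^^ n) cblinfun_id) =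
      (a ^ n /\<^sub>R fact n) *\<^sub>C e + (if n = 0 then cblinfun_id - e else 0)" for n
  proof (cases n)
    case (Suc m)
    show ?thesis
      unfolding Suc pow scaleR_conv_of_real[of _ "a ^ _"] scaleC_scaleC[symmetric] scaleC_of_real
      by simp
  qed simp
  have "(\<lambda>n. (a ^ n /\<^sub>R fact n) *\<^sub>C e) sums (exp a *\<^sub>C e)"
    by (rule bounded_linear.sums[OF bounded_linear_scaleC_left exp_converges])
  from sums_add[OF this sums_single[of 0 "\<lambda>_. cblinfun_id - e"]]
  show ?thesis
    unfolding cblinfun_exp_def term_eq by (rule sums_unique[symmetric])
qed

text \<open>The condition for hermitian operators at \<open>t = pi\<close>, where the scalar
  exponential is -1.\<close>

lemma hermitian_idempotent_reflection:
  assumes "hermitian e" "e o\<^sub>C e = e"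
  shows "norm (cblinfun_id - 2 *\<^sub>R e) = 1"
proof -
  have "norm (cblinfun_exp ((\<i> * of_real pi) *\<^sub>C e)) = 1"
    using assms(1) unfolding hermitian_def by blast
  moreover have "exp (\<i> * of_real pi) *\<^sub>C e = - e"
    by (simp add: scaleC_minus_left mult.commute)
  ultimately show ?thesis
    by (simp add: cblinfun_exp_idempotent[OF assms(2)] scaleR_2 algebra_simps)
qed


section \<open>Uniqueness of Moore-Penrose inverses\<close>

lemma contraction_id_plus_square_zero:
  fixes N :: "'a :: cbanach \<Rightarrow>\<^sub>C\<^sub>L 'a"
  assumes "N o\<^sub>C N = 0" and le: "norm (cblinfun_id + N) \<le> 1"
  shows "N = 0"
proof (rule cblinfun_eqI)
  fix x
  have NN: "cblinfun_apply N (cblinfun_apply N y) = 0" for y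
    using arg_cong[OF assms(1), of "\<lambda>f. cblinfun_apply f y"] by simp
  \<comment> \<open>These vectors are the iterates of the contraction \<open>cblinfun_id + N\<close>
    at \<open>x\<close>: each application adds one more copy of the image of \<open>x\<close>,
    because \<open>N\<close> vanishes on its own range.\<close>
  have pow: "norm (x + real k *\<^sub>R cblinfun_apply N x) \<le> norm x" for k
  proof (induction k)
    case (Suc k)
    let ?y = "x + real k *\<^sub>R cblinfun_apply N x"
    have "x + real (Suc k) *\<^sub>R cblinfun_apply N x = cblinfun_apply (cblinfun_id + N) ?y"
      by (simp add: cblinfun_apply_linear NN algebra_simps)
    also have "norm \<dots> \<le> norm (cblinfun_id + N) * norm ?y"
      by (rule norm_cblinfun_apply)
    also have "\<dots> \<le> 1 * norm ?y"
      by (intro mult_right_mono le norm_ge_zero)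
    finally show ?case using Suc.IH by simp
  qed simp
  have bound: "real k * norm (cblinfun_apply N x) \<le> 2 * norm x" for k
    using norm_triangle_ineq4[of "x + real k *\<^sub>R cblinfun_apply N x" x] pow[of k] by simp
  have "cblinfun_apply N x = 0"
  proof (rule ccontr)
    assume "cblinfun_apply N x \<noteq> 0"
    then have "0 < norm (cblinfun_apply N x)" by simp
    from reals_Archimedean3[OF this] bound show False
      by (meson not_less)
  qed
  then show "cblinfun_apply N x = cblinfun_apply 0 x" by simp
qed

lemma hermitian_idempotents_same_range_eq:
  assumes "hermitian e" "hermitian f" "e o\<^sub>C f = f" "f o\<^sub>C e = e"
  shows "e = f"
proof -
  have ef: "cblinfun_apply e (cblinfun_apply f x) = cblinfun_apply f x"
    "cblinfun_apply f (cblinfun_apply e x) = cblinfun_apply e x" for x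
    using arg_cong[OF assms(3), of "\<lambda>f. cblinfun_apply f x"]
      arg_cong[OF assms(4), of "\<lambda>f. cblinfun_apply f x"] by simp_all
  \<comment> \<open>For instance e e = e (f e) = (e f) e = f e = e.\<close>
  have idem: "e o\<^sub>C e = e" "f o\<^sub>C f = f"
    using assms(3,4) by (metis cblinfun_compose_assoc)+
  have app: "cblinfun_apply e (cblinfun_apply e x) = cblinfun_apply e x"
    "cblinfun_apply f (cblinfun_apply f x) = cblinfun_apply f x" for x
    using arg_cong[OF idem(1), of "\<lambda>f. cblinfun_apply f x"]
      arg_cong[OF idem(2), of "\<lambda>f. cblinfun_apply f x"] by simp_all
  have "(2 *\<^sub>R (f - e)) = 0"
  proof (rule contraction_id_plus_square_zero)
    show "2 *\<^sub>R (f - e) o\<^sub>C 2 *\<^sub>R (f - e) = 0"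
      by (rule cblinfun_eqI) (simp add: cblinfun_apply_linear ef app)
    \<comment> \<open>The cross term 4 e f of the product equals 4 f and turns -2 f into +2
      f.\<close>
    have "cblinfun_id + 2 *\<^sub>R (f - e) = (cblinfun_id - 2 *\<^sub>R e) o\<^sub>C (cblinfun_id - 2 *\<^sub>R f)"
      by (rule cblinfun_eqI) (simp add: cblinfun_apply_linear ef app algebra_simps flip: scaleR_2)
    then show "norm (cblinfun_id + 2 *\<^sub>R (f - e)) \<le> 1"
      using norm_cblinfun_compose[of "cblinfun_id - 2 *\<^sub>R e" "cblinfun_id - 2 *\<^sub>R f"]
      by (simp add: hermitian_idempotent_reflection assms(1,2) idem)
  qed
  then show ?thesis by simp
qed

text \<open>Adjoints swap ranges and kernels.\<close>

lemma hermitian_idempotents_same_kernel_eq: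
  assumes "hermitian e" "hermitian f" "e o\<^sub>C f = e" "f o\<^sub>C e = f"
  shows "e = f"
proof -
  have "cadjoint e = cadjoint f"
    by (rule hermitian_idempotents_same_range_eq)
      (simp_all add: assms hermitian_cadjoint_iff flip: cadjoint_compose)
  then show ?thesis by (simp add: cadjoint_inject)
qed

text \<open>From T S T = T = T S' T, the idempotents T S and T S' share their range, and S T and S'
  T share their kernel. Both pairs therefore coincide, and S = S T S = S' T S = S' T S' =
  S'.\<close>

lemma is_mp_inverse_unique:
  assumes S: "is_mp_inverse T S" and S': "is_mp_inverse T S'"
  shows "S = S'"
proof -
  have T: "T o\<^sub>C S o\<^sub>C T = T" "T o\<^sub>C S' o\<^sub>C T = T" and SS: "S o\<^sub>C T o\<^sub>C S = S" "S' o\<^sub>C T o\<^sub>C S' = S'"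
    and herm: "hermitian (T o\<^sub>C S)" "hermitian (T o\<^sub>C S')"
      "hermitian (S o\<^sub>C T)" "hermitian (S' o\<^sub>C T)"
    using S S' by (simp_all add: is_mp_inverse_def)
  have range: "T o\<^sub>C S = T o\<^sub>C S'"
    by (rule hermitian_idempotents_same_range_eq)
      (simp_all add: herm T flip: cblinfun_compose_assoc)
  have kernel: "S o\<^sub>C T = S' o\<^sub>C T"
    by (rule hermitian_idempotents_same_kernel_eq)
      (simp_all add: herm T[unfolded cblinfun_compose_assoc] cblinfun_compose_assoc)
  have "S = S' o\<^sub>C T o\<^sub>C S"
    using SS(1) kernel by simp
  also have "\<dots> = S'"
    using SS(2) range by (simp add: cblinfun_compose_assoc)
  finally show ?thesis .
qed

section \<open>Moore-Penrose inverses and adjoints\<close>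

lemma mp_inverse_eqI: "is_mp_inverse T S \<Longrightarrow> mp_inverse T = S"
  unfolding mp_inverse_def by (rule the_equality) (auto intro: is_mp_inverse_unique)

lemma is_mp_inverse_mp_inverse: "mp_invertible T \<Longrightarrow> is_mp_inverse T (mp_inverse T)"
  using mp_inverse_eqI by (auto simp: mp_invertible_def)

text \<open>Since the adjoint reverses products, the two hermitian conditions merely trade places,
  while both equations keep their palindromic shape.\<close>

lemma is_mp_inverse_cadjoint_iff: "is_mp_inverse (cadjoint T) (cadjoint S) \<longleftrightarrow> is_mp_inverse T S"
  unfolding is_mp_inverse_def cadjoint_compose[symmetric] hermitian_cadjoint_iff cadjoint_inject
    cblinfun_compose_assoc
  by blast

theorem theorem10:
  fixes T :: "'a :: cbanach \<Rightarrow>\<^sub>C\<^sub>L 'a"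
  shows "(mp_invertible T \<longrightarrow>
      mp_invertible (cadjoint T) \<and> mp_inverse (cadjoint T) = cadjoint (mp_inverse T)) \<and>
    (\<forall>S :: 'a \<Rightarrow>\<^sub>C\<^sub>L 'a. mp_invertible (cadjoint T) \<and> cadjoint S = mp_inverse (cadjoint T) \<longrightarrow>
      mp_invertible T \<and> S = mp_inverse T) \<and>
    (reflexive_space TYPE('a) \<longrightarrow> (mp_invertible T \<longleftrightarrow> mp_invertible (cadjoint T)))"
proof -
  have i: "mp_invertible (cadjoint T) \<and> mp_inverse (cadjoint T) = cadjoint (mp_inverse T)"
    if "mp_invertible T"
  proof -
    have "is_mp_inverse (cadjoint T) (cadjoint (mp_inverse T))"
      using is_mp_inverse_mp_inverse[OF that] by (simp add: is_mp_inverse_cadjoint_iff)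
    then show ?thesis
      using mp_inverse_eqI by (auto simp: mp_invertible_def)
  qed
  have ii: "mp_invertible T \<and> S = mp_inverse T"
    if "mp_invertible (cadjoint T)" "cadjoint S = mp_inverse (cadjoint T)" for S
  proof -
    have "is_mp_inverse T S"
      using is_mp_inverse_mp_inverse[OF that(1)]
      unfolding that(2)[symmetric] is_mp_inverse_cadjoint_iff .
    then show ?thesis
      using mp_inverse_eqI by (auto simp: mp_invertible_def)
  qed
  \<comment> \<open>Reflexivity makes the Moore-Penrose inverse of the adjoint itself an adjoint, so
    \<open>ii\<close> applies.\<close>
  have "mp_invertible T" if "reflexive_space TYPE('a)" "mp_invertible (cadjoint T)"
    using reflexive_imp_surj_cadjoint[OF that(1), of "mp_inverse (cadjoint T)"] ii[OF that(2)] by blast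
  with i ii show ?thesis by blast
qed

end
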